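(* Let $\mathbb{F}$ be an arbitrary field (of any characteristic, including $2$). Let $\mathcal{J}$ be the three-dimensional Lie algebra over $\mathbb{F}$ with basis $\{h,x,y\}$ and $[h,x]=x$, $[h,y]=-y$, $[x,y]=h$, and let $\mathcal{K}$ be the three-dimensional Lie algebra over $\mathbb{F}$ with basis $\{e_1,e_2,e_3\}$ and $[e_1,e_2]=e_3$, $[e_2,e_3]=e_1$, $[e_3,e_1]=e_2$. Both $\mathcal{J}$ and $\mathcal{K}$ are simple. Let $\mathcal{L}=\mathcal{J}\oplus\mathcal{K}$ be the direct sum of Lie algebras (of dimension $6$). Then the decomposition $\mathcal{L}=\mathcal{L}_\alpha\oplus\mathcal{L}_\beta\oplus\mathcal{L}_\gamma\oplus\mathcal{L}_\delta\oplus\mathcal{L}_\mu$ given by $$\mathcal{L}_\alpha=\mathbb{F}h+\mathbb{F}e_1,\quad \mathcal{L}_\beta=\mathbb{F}x,\quad \mathcal{L}_\gamma=\mathbb{F}y,\quad \mathcal{L}_\delta=\mathbb{F}e_2,\quad \mathcal{L}_\mu=\mathbb{F}e_3,$$ indexed by the five-element set $G=\{\alpha,\beta,\gamma,\delta,\mu\}$, is a Lie grading on $\mathcal{L}$ which is not a semigroup grading; that is, there is no semigroup (commutative or not) $\Gamma$, with operation written as juxtaposition, together with an injective map $\iota\colon G\to\Gamma$ such that $\iota(g)\iota(g')=\iota(g'')$ whenever $g,g',g''\in G$ satisfy $0\neq[\mathcal{L}_g,\mathcal{L}_{g'}]\subseteq\mathcal{L}_{g''}$. Moreover, this Lie grading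 is a coarsening of a group grading on $\mathcal{L}$, namely of the $\mathbb{Z}\times(\mathbb{Z}/2\mathbb{Z})^2$-grading on $\mathcal{L}$ with one-dimensional homogeneous components in which $h,x,y$ have degrees $(0,\bar 0,\bar 0)$, $(1,\bar 0,\bar 0)$, $(-1,\bar 0,\bar 0)$ and $e_1,e_2,e_3$ have degrees $(0,\bar 1,\bar 0)$, $(0,\bar 0,\bar 1)$, $(0,\bar 1,\bar 1)$, respectively.
   Context: A Lie grading on a Lie algebra $\mathcal{L}$ over a field $\mathbb{F}$ is a decomposition of $\mathcal{L}$ into a direct sum of subspaces $\mathcal{L}=\bigoplus_{g\in G}\mathcal{L}_g$ indexed by a set $G$, such that $\mathcal{L}_g\neq 0$ for every $g\in G$, and for any $g,g'\in G$ either $[\mathcal{L}_g,\mathcal{L}_{g'}]=0$ or there exists $g''\in G$ such that $0\neq[\mathcal{L}_g,\mathcal{L}_{g'}]\subseteq\mathcal{L}_{g''}$. Here $[\mathcal{L}_g,\mathcal{L}_{g'}]$ denotes the linear span of all brackets $[x,y]$ with $x\in\mathcal{L}_g$, $y\in\mathcal{L}_{g'}$. A grading by an abelian group $A$ is a decomposition $\mathcal{L}=\bigoplus_{a\in A}\mathcal{L}_a$ (components allowed to be zero) with $[\mathcal{L}_a,\mathcal{L}_b]\subseteq\mathcal{L}_{a+b}$ for all $a,b\in A$; its nonzero components form a Lie grading. A grading $\mathcal{L}=\bigoplus_{\gamma\in\Gamma}\mathcal{L}_\gamma$ is a coarsening of a grading $\mathcal{L}=\bigoplus_{g\in G}\mathcal{L}_g$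 if for every $g\in G$ there is $\gamma\in\Gamma$ with $\mathcal{L}_g\subseteq\mathcal{L}_\gamma$. Brackets of basis elements not listed are determined by bilinearity and the alternating property, and $[\mathcal{J},\mathcal{K}]=0$ in the direct sum. *)

theory Defs
  imports "HOL-Analysis.Cartesian_Space" "HOL-Analysis.Product_Vector" "HOL-Library.Z2"
begin

section \<open>Lie algebras and gradings\<close>

locale lie_algebra = vector_space scale
  for scale :: "'f::field \<Rightarrow> 'v::ab_group_add \<Rightarrow> 'v" +
  fixes bracket :: "'v \<Rightarrow> 'v \<Rightarrow> 'v"
  assumes linear_bracket_left: "Vector_Spaces.linear scale scale (\<lambda>u. bracket u v)"
    and linear_bracket_right: "Vector_Spaces.linear scale scale (\<lambda>v. bracket u v)"
    and bracket_self: "bracket u u = 0"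
    and jacobi: "bracket u (bracket v w) + bracket v (bracket w u) + bracket w (bracket u v) = 0"
begin

definition basis :: "'v set \<Rightarrow> bool" where
  "basis B \<longleftrightarrow> independent B \<and> span B = UNIV"

definition ideal :: "'v set \<Rightarrow> bool" where
  "ideal I \<longleftrightarrow> subspace I \<and> (\<forall>u. \<forall>v\<in>I. bracket u v \<in> I)"

definition simple :: bool where
  "simple \<longleftrightarrow> (\<exists>u v. bracket u v \<noteq> 0) \<and> (\<forall>I. ideal I \<longrightarrow> I = {0} \<or> I = UNIV)"

definition bracket_span :: "'v set \<Rightarrow> 'v set \<Rightarrow> 'v set" where
  "bracket_span U V = span {bracket u v | u v. u \<in> U \<and> v \<in> V}"

definition direct_sum_decomposition :: "'i set \<Rightarrow> ('i \<Rightarrow> 'v set) \<Rightarrow> bool" where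
  "direct_sum_decomposition G C \<longleftrightarrow>
     (\<forall>g\<in>G. subspace (C g)) \<and>
     (\<forall>v. \<exists>!f. (\<forall>g\<in>G. f g \<in> C g) \<and> (\<forall>g. g \<notin> G \<longrightarrow> f g = 0) \<and>
               finite {g. f g \<noteq> 0} \<and> v = (\<Sum>g | f g \<noteq> 0. f g))"

definition lie_grading :: "'i set \<Rightarrow> ('i \<Rightarrow> 'v set) \<Rightarrow> bool" where
  "lie_grading G C \<longleftrightarrow>
     direct_sum_decomposition G C \<and>
     (\<forall>g\<in>G. C g \<noteq> {0}) \<and>
     (\<forall>g\<in>G. \<forall>g'\<in>G. bracket_span (C g) (C g') = {0} \<or>
        (\<exists>g''\<in>G. bracket_span (C g) (C g') \<noteq> {0} \<and> bracket_span (C g) (C g') \<subseteq> C g''))"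

text \<open>
  Since HOL has no quantification over types, the type of \<open>mult\<close> is a parameter.
  A Lie grading fails to be a semigroup grading if no \<open>mult\<close>
  and \<open>\<iota>\<close> satisfy this condition, over an arbitrary type \<open>'s\<close>.
\<close>
definition semigroup_realization ::
    "'i set \<Rightarrow> ('i \<Rightarrow> 'v set) \<Rightarrow> ('s \<Rightarrow> 's \<Rightarrow> 's) \<Rightarrow> ('i \<Rightarrow> 's) \<Rightarrow> bool" where
  "semigroup_realization G C mult \<iota> \<longleftrightarrow>
     semigroup mult \<and> inj_on \<iota> G \<and>
     (\<forall>g\<in>G. \<forall>g'\<in>G. \<forall>g''\<in>G.
        bracket_span (C g) (C g') \<noteq> {0} \<and> bracket_span (C g) (C g') \<subseteq> C g'' \<longrightarrow>
        mult (\<iota> g) (\<iota> g') = \<iota> g'')"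

definition group_grading :: "('a::ab_group_add \<Rightarrow> 'v set) \<Rightarrow> bool" where
  "group_grading C \<longleftrightarrow>
     direct_sum_decomposition UNIV C \<and>
     (\<forall>a b. bracket_span (C a) (C b) \<subseteq> C (a + b))"

definition coarsening :: "'j set \<Rightarrow> ('j \<Rightarrow> 'v set) \<Rightarrow> 'i set \<Rightarrow> ('i \<Rightarrow> 'v set) \<Rightarrow> bool" where
  "coarsening \<Gamma> D G C \<longleftrightarrow>
     lie_grading \<Gamma> D \<and> lie_grading G C \<and> (\<forall>g\<in>G. \<exists>\<gamma>\<in>\<Gamma>. C g \<subseteq> D \<gamma>)"

end


section \<open>The algebras \<open>\<J>\<close>, \<open>\<K>\<close> and \<open>\<L> = \<J> \<oplus> \<K>\<close>\<close>

type_synonym 'f three_space = "'f ^ 3"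
type_synonym 'f six_space = "'f three_space \<times> 'f three_space"

definition hJ :: "'f::field three_space" where "hJ = axis 1 1"
definition xJ :: "'f::field three_space" where "xJ = axis 2 1"
definition yJ :: "'f::field three_space" where "yJ = axis 3 1"

definition bracketJ :: "'f::field three_space \<Rightarrow> 'f three_space \<Rightarrow> 'f three_space" where
  "bracketJ u v =
     (u $ 1 * v $ 2 - u $ 2 * v $ 1) *s xJ
     - (u $ 1 * v $ 3 - u $ 3 * v $ 1) *s yJ
     + (u $ 2 * v $ 3 - u $ 3 * v $ 2) *s hJ"

definition e1 :: "'f::field three_space" where "e1 = axis 1 1"
definition e2 :: "'f::field three_space" where "e2 = axis 2 1"
definition e3 :: "'f::field three_space" where "e3 = axis 3 1"

definition bracketK :: "'f::field three_space \<Rightarrow> 'f three_space \<Rightarrow> 'f three_space" where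
  "bracketK u v =
     (u $ 1 * v $ 2 - u $ 2 * v $ 1) *s e3
     + (u $ 2 * v $ 3 - u $ 3 * v $ 2) *s e1
     + (u $ 3 * v $ 1 - u $ 1 * v $ 3) *s e2"

abbreviation scaleL :: "'f::field \<Rightarrow> 'f six_space \<Rightarrow> 'f six_space" where
  "scaleL \<equiv> module_prod.scale (*s) (*s)"

definition bracketL :: "'f::field six_space \<Rightarrow> 'f six_space \<Rightarrow> 'f six_space" where
  "bracketL p q = (bracketJ (fst p) (fst q), bracketK (snd p) (snd q))"

abbreviation spanL :: "'f::field six_space set \<Rightarrow> 'f six_space set" where
  "spanL \<equiv> module.span scaleL"


section \<open>The two gradings of \<open>\<L>\<close>\<close>

datatype label = L_\<alpha> | L_\<beta> | L_\<gamma> | L_\<delta> | L_\<mu>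

fun five_comp :: "label \<Rightarrow> 'f::field six_space set" where
  "five_comp L_\<alpha> = spanL {(hJ, 0), (0, e1)}"
| "five_comp L_\<beta> = spanL {(xJ, 0)}"
| "five_comp L_\<gamma> = spanL {(yJ, 0)}"
| "five_comp L_\<delta> = spanL {(0, e2)}"
| "five_comp L_\<mu> = spanL {(0, e3)}"

definition fine_comp :: "int \<times> bit \<times> bit \<Rightarrow> 'f::field six_space set" where
  "fine_comp a =
     (if a = (0, 0, 0) then spanL {(hJ, 0)}
      else if a = (1, 0, 0) then spanL {(xJ, 0)}
      else if a = (- 1, 0, 0) then spanL {(yJ, 0)}
      else if a = (0, 1, 0) then spanL {(0, e1)}
      else if a = (0, 0, 1) then spanL {(0, e2)}
      else if a = (0, 1, 1) then spanL {(0, e3)}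
      else {0})"

end

(*
  In a semigroup realization, write g for the image of a label. Associativity gives
  \<alpha>\<alpha> = \<alpha>(\<beta>\<gamma>) = (\<alpha>\<beta>)\<gamma> = \<beta>\<gamma> = \<alpha> from the brackets in J, hence
  \<delta> = \<alpha>\<mu> = \<alpha>(\<alpha>\<delta>) = (\<alpha>\<alpha>)\<delta> = \<alpha>\<delta> = \<mu> from the brackets in K,
  contradicting injectivity. The positive claims reduce to coordinates: every component of
  either grading is spanned by some of the six basis vectors.
*)

theory Submission
  imports Defs
begin

section \<open>General tools for ideals, bracket spans and gradings\<close>

context lie_algebra
begin

lemma simpleI:
  assumes "bracket u v \<noteq> 0"
    and "\<And>I w. ideal I \<Longrightarrow> w \<in> I \<Longrightarrow> w \<noteq> 0 \<Longrightarrow> I = UNIV"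
  shows simple
  using assms subspace_0 unfolding simple_def ideal_def by blast

lemma ideal_bracket_right: "ideal I \<Longrightarrow> v \<in> I \<Longrightarrow> bracket u v \<in> I"
  by (simp add: ideal_def)

lemma ideal_scaleD: "ideal I \<Longrightarrow> scale c v \<in> I \<Longrightarrow> c \<noteq> 0 \<Longrightarrow> v \<in> I"
  using subspace_scale[of I "scale c v" "inverse c"] by (simp add: ideal_def)

lemma bracket_span_subset:
  assumes "subspace W" "\<And>u v. u \<in> U \<Longrightarrow> v \<in> V \<Longrightarrow> bracket u v \<in> W"
  shows "bracket_span U V \<subseteq> W"
  unfolding bracket_span_def using assms by (intro span_minimal) auto

lemma bracket_in_bracket_span: "u \<in> U \<Longrightarrow> v \<in> V \<Longrightarrow> bracket u v \<in> bracket_span U V"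
  unfolding bracket_span_def by (rule span_base) blast

lemma bracket_span_eq_0:
  assumes "\<And>u v. u \<in> U \<Longrightarrow> v \<in> V \<Longrightarrow> bracket u v = 0"
  shows "bracket_span U V = {0}"
  using bracket_span_subset[of "{0}" U V] assms span_zero
  unfolding bracket_span_def by (auto simp: subspace_single_0)

text \<open>Elementwise containment in a component is enough, with no check that the bracket span is
  nonzero: if it vanishes, the first alternative of \<open>lie_grading\<close> holds anyway.\<close>

lemma lie_gradingI:
  assumes "direct_sum_decomposition G C" "\<And>g. g \<in> G \<Longrightarrow> C g \<noteq> {0}"
    and "\<And>g g'. g \<in> G \<Longrightarrow> g' \<in> G \<Longrightarrow>
      (\<forall>u\<in>C g. \<forall>v\<in>C g'. bracket u v = 0) \<or> (\<exists>g''\<in>G. \<forall>u\<in>C g. \<forall>v\<in>C g'. bracket u v \<in> C g'')"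
  shows "lie_grading G C"
  unfolding lie_grading_def
proof (intro conjI ballI)
  fix g g' assume "g \<in> G" "g' \<in> G"
  from assms(3)[OF this] show "bracket_span (C g) (C g') = {0} \<or>
    (\<exists>g''\<in>G. bracket_span (C g) (C g') \<noteq> {0} \<and> bracket_span (C g) (C g') \<subseteq> C g'')"
  proof
    assume "\<forall>u\<in>C g. \<forall>v\<in>C g'. bracket u v = 0"
    then show ?thesis
      using bracket_span_eq_0[of "C g" "C g'"] by simp
  next
    assume "\<exists>g''\<in>G. \<forall>u\<in>C g. \<forall>v\<in>C g'. bracket u v \<in> C g''"
    then obtain g'' where "g'' \<in> G" "\<forall>u\<in>C g. \<forall>v\<in>C g'. bracket u v \<in> C g''" ..
    moreover have "subspace (C g'')"
      using assms(1) \<open>g'' \<in> G\<close> by (simp add: direct_sum_decomposition_def)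
    ultimately show ?thesis
      using bracket_span_subset[of "C g''" "C g" "C g'"] by auto
  qed
qed (use assms in auto)

text \<open>Extracts one entry of the multiplication table: a single pair with nonzero bracket shows
  that the bracket span is nonzero, and containment is tested on elements.\<close>

lemma semigroup_realization_mult:
  assumes "semigroup_realization G C mult \<iota>" "g \<in> G" "g' \<in> G" "g'' \<in> G" "subspace (C g'')"
    and "u \<in> C g" "v \<in> C g'" "bracket u v \<noteq> 0"
    and "\<And>u v. u \<in> C g \<Longrightarrow> v \<in> C g' \<Longrightarrow> bracket u v \<in> C g''"
  shows "mult (\<iota> g) (\<iota> g') = \<iota> g''"
proof -
  have "bracket_span (C g) (C g') \<noteq> {0}"
    using bracket_in_bracket_span[OF assms(6,7)] assms(8) by auto
  moreover have "bracket_span (C g) (C g') \<subseteq> C g''"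
    using assms(5,9) by (rule bracket_span_subset)
  ultimately show ?thesis
    using assms(1-4) by (simp add: semigroup_realization_def)
qed

text \<open>Where \<open>C g = {0}\<close>, lying in \<open>C g\<close> and being zero are the same
  condition, so both index sets admit the same families \<open>f\<close>.\<close>

lemma direct_sum_decomposition_support:
  assumes "direct_sum_decomposition UNIV C"
  shows "direct_sum_decomposition {a. C a \<noteq> {0}} C"
proof -
  have sub: "subspace (C a)" for a
    using assms by (simp add: direct_sum_decomposition_def)
  have "(\<forall>g\<in>{a. C a \<noteq> {0}}. f g \<in> C g) \<and> (\<forall>g. g \<notin> {a. C a \<noteq> {0}} \<longrightarrow> f g = 0) \<longleftrightarrow>
    (\<forall>g\<in>UNIV. f g \<in> C g) \<and> (\<forall>g. g \<notin> UNIV \<longrightarrow> f g = 0)" for f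
    using subspace_0[OF sub] by fastforce
  \<comment> \<open>Reassociating groups the two pointwise conditions on \<open>f\<close> as they
    stand in the equivalence.\<close>
  then show ?thesis
    using assms by (simp only: direct_sum_decomposition_def conj_assoc[symmetric]) auto
qed

text \<open>The bracket of two components either lands in a component \<open>C (a + b)\<close> that
  survives the restriction, or \<open>C (a + b)\<close> is zero and so is the bracket.\<close>

lemma lie_grading_group_grading:
  assumes "group_grading C"
  shows "lie_grading {a. C a \<noteq> {0}} C"
proof (rule lie_gradingI)
  show "direct_sum_decomposition {a. C a \<noteq> {0}} C"
    using assms by (auto simp: group_grading_def intro: direct_sum_decomposition_support)
  fix a b
  have "\<forall>u\<in>C a. \<forall>v\<in>C b. bracket u v \<in> C (a + b)"
    using assms bracket_in_bracket_span by (fastforce simp: group_grading_def)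
  then show "(\<forall>u\<in>C a. \<forall>v\<in>C b. bracket u v = 0) \<or>
      (\<exists>c\<in>{a. C a \<noteq> {0}}. \<forall>u\<in>C a. \<forall>v\<in>C b. bracket u v \<in> C c)"
    by (cases "C (a + b) = {0}") auto
qed auto

text \<open>The projections of \<open>v\<close> give a decomposition; conversely, applying
  \<open>p h\<close> to any decomposition kills every summand except the one of index
  \<open>h\<close>. The finite set \<open>S\<close> carries all sums, since \<open>G\<close> may be
  infinite.\<close>

lemma direct_sum_decomposition_projections:
  assumes sub: "\<And>g. g \<in> G \<Longrightarrow> subspace (C g)"
    and add: "\<And>g u v. p g (u + v) = p g u + p g v"
    and p_in: "\<And>g v. g \<in> G \<Longrightarrow> p g v \<in> C g"
    and S: "finite S" "S \<subseteq> G" "\<And>g v. g \<notin> S \<Longrightarrow> p g v = 0"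
    and sum: "\<And>v. (\<Sum>g\<in>S. p g v) = v"
    and proj: "\<And>g h v. g \<in> G \<Longrightarrow> v \<in> C g \<Longrightarrow> p h v = (if h = g then v else 0)"
  shows "direct_sum_decomposition G C"
  unfolding direct_sum_decomposition_def
proof (intro conjI ballI allI ex1I)
  fix v
  have supp: "{g. p g v \<noteq> 0} \<subseteq> S"
    using S(3) by auto
  show "finite {g. p g v \<noteq> 0}"
    using supp S(1) finite_subset by blast
  show "v = (\<Sum>g | p g v \<noteq> 0. p g v)"
    using sum.mono_neutral_left[OF S(1) supp, of "\<lambda>g. p g v"] sum[of v] by auto
next
  fix v f
  assume f: "(\<forall>g\<in>G. f g \<in> C g) \<and> (\<forall>g. g \<notin> G \<longrightarrow> f g = 0) \<and>
    finite {g. f g \<noteq> 0} \<and> v = (\<Sum>g | f g \<noteq> 0. f g)"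
  show "f = (\<lambda>h. p h v)"
  proof
    fix h
    \<comment> \<open>Additivity alone lets \<open>p h\<close> pass through finite sums.\<close>
    interpret additive "p h"
      by standard (rule add)
    have "p h v = (\<Sum>g | f g \<noteq> 0. p h (f g))"
      using f by (simp add: sum)
    also have "\<dots> = (\<Sum>g | f g \<noteq> 0. if h = g then f g else 0)"
    proof (rule sum.cong)
      fix g assume "g \<in> {g. f g \<noteq> 0}"
      then show "p h (f g) = (if h = g then f g else 0)"
        using f by (intro proj) auto
    qed simp
    also have "\<dots> = f h"
      using f by (simp add: sum.delta')
    finally show "f h = p h v" ..
  qed
qed (use sub p_in S in blast)+

end

section \<open>Coordinates and the Lie axioms for J and K\<close>

lemmas coord_simps = vec_eq_iff forall_3 axis_def
  hJ_def xJ_def yJ_def bracketJ_def e1_def e2_def e3_def bracketK_def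

lemma bracketJ_nth:
  "bracketJ u v $ 1 = u $ 2 * v $ 3 - u $ 3 * v $ 2"
  "bracketJ u v $ 2 = u $ 1 * v $ 2 - u $ 2 * v $ 1"
  "bracketJ u v $ 3 = u $ 3 * v $ 1 - u $ 1 * v $ 3"
  by (simp_all add: bracketJ_def hJ_def xJ_def yJ_def axis_def)

lemma bracketK_nth:
  "bracketK u v $ 1 = u $ 2 * v $ 3 - u $ 3 * v $ 2"
  "bracketK u v $ 2 = u $ 3 * v $ 1 - u $ 1 * v $ 3"
  "bracketK u v $ 3 = u $ 1 * v $ 2 - u $ 2 * v $ 1"
  by (simp_all add: bracketK_def e1_def e2_def e3_def axis_def)

text \<open>Each axiom becomes a polynomial identity with integer coefficients in the coordinates,
  valid in every characteristic.\<close>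

lemma lie_algebra_bracketJ: "lie_algebra (*s) (bracketJ :: 'f::field three_space \<Rightarrow> _)"
  by unfold_locales (auto simp: coord_simps algebra_simps)

lemma lie_algebra_bracketK: "lie_algebra (*s) (bracketK :: 'f::field three_space \<Rightarrow> _)"
  by unfold_locales (auto simp: coord_simps algebra_simps)

interpretation J: lie_algebra "(*s)" "bracketJ :: 'f::field three_space \<Rightarrow> _"
  by (rule lie_algebra_bracketJ)

interpretation K: lie_algebra "(*s)" "bracketK :: 'f::field three_space \<Rightarrow> _"
  by (rule lie_algebra_bracketK)

section \<open>Simplicity of J and K\<close>

lemma cart_basis_3: "cart_basis = {axis 1 1, axis 2 1, axis 3 1 :: 'f::field ^ 3}"
  by (auto simp: cart_basis_def) (metis exhaust_3)

lemma basis_axes: "J.basis {axis 1 1, axis 2 1, axis 3 1 :: 'f::field three_space}"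
  using independent_cart_basis[where 'a='f and 'b=3] span_cart_basis[where 'a='f and 'b=3]
  by (auto simp: J.basis_def cart_basis_3)

lemma subspace_axes_UNIV:
  fixes I :: "'f::field three_space set"
  assumes "vec.subspace I" "axis 1 1 \<in> I" "axis 2 1 \<in> I" "axis 3 1 \<in> I"
  shows "I = UNIV"
  using vec.span_minimal[of cart_basis I] assms
  unfolding span_cart_basis by (auto simp: cart_basis_3)

text \<open>A nonzero ideal contains one of h, x, y, and each of these produces the other two by
  brackets. All scalars divided by are signs or nonzero coordinates, never 2, so characteristic 2 is
  covered.\<close>

lemma simple_bracketJ: "lie_algebra.simple (*s) (bracketJ :: 'f::field three_space \<Rightarrow> _)"
proof (rule J.simpleI)
  show "bracketJ hJ xJ \<noteq> (0 :: 'f three_space)"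
    by (simp add: coord_simps)
next
  fix I :: "'f three_space set" and w
  assume I: "J.ideal I" and w: "w \<in> I" "w \<noteq> 0"
  note closed = J.ideal_bracket_right[OF I] and unscale = J.ideal_scaleD[OF I]
  \<comment> \<open>Bracketing twice with x leaves only the y-coordinate of \<open>w\<close>, and
    twice with y only the x-coordinate.\<close>
  have "bracketJ xJ (bracketJ xJ w) = (- w $ 3) *s xJ" "bracketJ yJ (bracketJ yJ w) = (- w $ 2) *s yJ"
    by (simp_all add: coord_simps)
  then have "(- w $ 3) *s xJ \<in> I" "(- w $ 2) *s yJ \<in> I"
    using closed[OF closed[OF w(1)], of xJ xJ] closed[OF closed[OF w(1)], of yJ yJ] by simp_all
  then have c: "w $ 3 \<noteq> 0 \<Longrightarrow> xJ \<in> I" and b: "w $ 2 \<noteq> 0 \<Longrightarrow> yJ \<in> I"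
    using unscale[of "- w $ 3" xJ] unscale[of "- w $ 2" yJ] by simp_all
  \<comment> \<open>In the remaining case \<open>w\<close> is itself a nonzero multiple of
    h.\<close>
  have a: "hJ \<in> I" if "w $ 2 = 0" "w $ 3 = 0"
  proof (rule unscale)
    show "w $ 1 \<noteq> 0"
      using w(2) that by (simp add: vec_eq_iff forall_3)
    have "w $ 1 *s hJ = w"
      using that by (simp add: coord_simps)
    then show "w $ 1 *s hJ \<in> I"
      using w(1) by simp
  qed
  \<comment> \<open>Signs are written as scalars so that \<open>unscale\<close> can remove
    them.\<close>
  have "bracketJ yJ xJ = (- 1 :: 'f) *s hJ" "bracketJ xJ yJ = (1 :: 'f) *s hJ"
    "bracketJ xJ hJ = (- 1 :: 'f) *s xJ" "bracketJ yJ hJ = (1 :: 'f) *s yJ"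
    by (simp_all add: coord_simps)
  then have h: "xJ \<in> I \<Longrightarrow> hJ \<in> I" "yJ \<in> I \<Longrightarrow> hJ \<in> I"
    and xy: "hJ \<in> I \<Longrightarrow> xJ \<in> I" "hJ \<in> I \<Longrightarrow> yJ \<in> I"
    using closed[of xJ yJ] closed[of yJ xJ] closed[of hJ xJ] closed[of hJ yJ]
      unscale[of "- 1" hJ] unscale[of "- 1" xJ] by auto
  have "hJ \<in> I"
    using a b c h by blast
  then show "I = UNIV"
    using I xy by (intro subspace_axes_UNIV) (auto simp: J.ideal_def hJ_def xJ_def yJ_def)
qed

text \<open>Bracketing with two different basis vectors isolates one coordinate of \<open>w\<close>,
  whereas twice the same one would keep two. So a nonzero ideal contains some basis vector, and the
  cyclic relations give the rest.\<close>

lemma simple_bracketK: "lie_algebra.simple (*s) (bracketK :: 'f::field three_space \<Rightarrow> _)"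
proof (rule K.simpleI)
  show "bracketK e1 e2 \<noteq> (0 :: 'f three_space)"
    by (simp add: coord_simps)
next
  fix I :: "'f three_space set" and w
  assume I: "K.ideal I" and w: "w \<in> I" "w \<noteq> 0"
  note closed = K.ideal_bracket_right[OF I] and unscale = K.ideal_scaleD[OF I]
  have "bracketK e1 (bracketK e2 w) = (w $ 1) *s e2" "bracketK e2 (bracketK e3 w) = (w $ 2) *s e3"
    "bracketK e3 (bracketK e1 w) = (w $ 3) *s e1"
    by (simp_all add: coord_simps)
  then have "(w $ 1) *s e2 \<in> I" "(w $ 2) *s e3 \<in> I" "(w $ 3) *s e1 \<in> I"
    using closed[OF closed[OF w(1)], of e1 e2] closed[OF closed[OF w(1)], of e2 e3]
      closed[OF closed[OF w(1)], of e3 e1] by simp_all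
  then have abc: "w $ 1 \<noteq> 0 \<Longrightarrow> e2 \<in> I" "w $ 2 \<noteq> 0 \<Longrightarrow> e3 \<in> I" "w $ 3 \<noteq> 0 \<Longrightarrow> e1 \<in> I"
    by (blast intro: unscale)+
  have "bracketK e1 e2 = (e3 :: 'f three_space)" "bracketK e2 e3 = (e1 :: 'f three_space)"
    "bracketK e3 e1 = (e2 :: 'f three_space)"
    by (simp_all add: coord_simps)
  then have cyc: "e2 \<in> I \<Longrightarrow> e3 \<in> I" "e3 \<in> I \<Longrightarrow> e1 \<in> I" "e1 \<in> I \<Longrightarrow> e2 \<in> I"
    using closed[of e2 e1] closed[of e3 e2] closed[of e1 e3] by simp_all
  have "w $ 1 \<noteq> 0 \<or> w $ 2 \<noteq> 0 \<or> w $ 3 \<noteq> 0"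
    using w by (simp add: vec_eq_iff forall_3)
  then show "I = UNIV"
    using I abc cyc by (intro subspace_axes_UNIV) (auto simp: K.ideal_def e1_def e2_def e3_def)
qed

section \<open>The direct sum L and gradings given by degrees of basis vectors\<close>

interpretation vp: finite_dimensional_vector_space_prod
  "(*s) :: 'f::field \<Rightarrow> 'f three_space \<Rightarrow> _" "(*s) :: 'f \<Rightarrow> 'f three_space \<Rightarrow> _" cart_basis cart_basis
  by unfold_locales

lemma lie_algebra_bracketL: "lie_algebra scaleL (bracketL :: 'f::field six_space \<Rightarrow> _)"
  by unfold_locales (auto simp: vp.scale_def bracketL_def prod_eq_iff coord_simps algebra_simps)

interpretation L: lie_algebra scaleL "bracketL :: 'f::field six_space \<Rightarrow> _"
  by (rule lie_algebra_bracketL)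

lemma dim_six_space: "vp.p.dim (UNIV :: 'f::field six_space set) = 6"
  using vp.dim_Times[of UNIV UNIV] by (simp add: card_cart_basis)

text \<open>Here \<open>d i\<close> and \<open>d' i\<close> are the degrees of the \<open>i\<close>-th basis vectors of \<open>\<J>\<close> and \<open>\<K>\<close>.\<close>

definition graded_comp :: "(3 \<Rightarrow> 'i) \<Rightarrow> (3 \<Rightarrow> 'i) \<Rightarrow> 'i \<Rightarrow> 'f::field six_space set" where
  "graded_comp d d' g =
     {p. (\<forall>i. d i \<noteq> g \<longrightarrow> fst p $ i = 0) \<and> (\<forall>i. d' i \<noteq> g \<longrightarrow> snd p $ i = 0)}"

lemma subspace_graded_comp: "vp.p.subspace (graded_comp d d' g)"
  by (auto simp: graded_comp_def vp.p.subspace_def vp.scale_def)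

lemma direct_sum_decomposition_graded_comp:
  assumes "range d \<union> range d' \<subseteq> G"
  shows "L.direct_sum_decomposition G (graded_comp d d' :: _ \<Rightarrow> 'f::field six_space set)"
proof -
  \<comment> \<open>The projection to degree \<open>g\<close> keeps exactly the coordinates whose
    basis vector has degree \<open>g\<close>; only the degrees in the two ranges occur.\<close>
  let ?p = "\<lambda>g v :: 'f six_space. (\<chi> i. if d i = g then fst v $ i else 0,
    \<chi> i. if d' i = g then snd v $ i else 0)"
  show ?thesis
  proof (rule L.direct_sum_decomposition_projections[where p = ?p and S = "range d \<union> range d'"])
    fix v :: "'f six_space"
    show "(\<Sum>g\<in>range d \<union> range d'. ?p g v) = v"
      by (auto simp: prod_eq_iff fst_sum snd_sum vec_eq_iff)
    show "?p h v = (if h = g then v else 0)" if "v \<in> graded_comp d d' g" for g h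
      using that by (auto simp: graded_comp_def prod_eq_iff vec_eq_iff)
      show "?p g v = 0" if "g \<notin> range d \<union> range d'" for g
      using that by (auto simp: vec_eq_iff zero_prod_def)
    show "?p g v \<in> graded_comp d d' g" for g
      by (simp add: graded_comp_def)
    show "?p g (u + v) = ?p g u + ?p g v" for g and u :: "'f six_space"
      by (simp add: vec_eq_iff)
  qed (use assms in \<open>auto simp: subspace_graded_comp\<close>)
qed

text \<open>The hypotheses state additivity of degrees on the nonzero brackets of basis vectors, one
  order of each pair; commutativity supplies the other order.\<close>

lemma group_grading_graded_comp:
  fixes d d' :: "3 \<Rightarrow> 'a::ab_group_add"
  assumes "d 1 + d 2 = d 2" "d 1 + d 3 = d 3" "d 2 + d 3 = d 1"
    and "d' 1 + d' 2 = d' 3" "d' 2 + d' 3 = d' 1" "d' 3 + d' 1 = d' 2"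
  shows "L.group_grading (graded_comp d d' :: _ \<Rightarrow> 'f::field six_space set)"
  unfolding L.group_grading_def
proof (intro conjI allI L.bracket_span_subset)
  fix a b and u v :: "'f six_space"
  assume "u \<in> graded_comp d d' a" "v \<in> graded_comp d d' b"
  \<comment> \<open>If the degrees do not add up to \<open>a + b\<close>, then \<open>d i\<close>
    differs from \<open>a\<close> or \<open>d j\<close> from \<open>b\<close>, and one factor
    vanishes.\<close>
  then have J: "d i + d j \<noteq> a + b \<Longrightarrow> fst u $ i * fst v $ j = 0"
    and K: "d' i + d' j \<noteq> a + b \<Longrightarrow> snd u $ i * snd v $ j = 0" for i j
    by (auto simp: graded_comp_def)
  have swap: "d 2 + d 1 = d 2" "d 3 + d 1 = d 3" "d 3 + d 2 = d 1"
    "d' 2 + d' 1 = d' 3" "d' 3 + d' 2 = d' 1" "d' 1 + d' 3 = d' 2"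
    using assms by (simp_all add: add.commute)
  note J[of 1 2] J[of 2 1] J[of 1 3] J[of 3 1] J[of 2 3] J[of 3 2]
    K[of 1 2] K[of 2 1] K[of 1 3] K[of 3 1] K[of 2 3] K[of 3 2]
  \<comment> \<open>Each sum of degrees turns into the degree of the coordinate of the bracket in
    which that product occurs.\<close>
  note this[unfolded assms swap]
  then show "bracketL u v \<in> graded_comp d d' (a + b)"
    by (auto simp: graded_comp_def bracketL_def forall_3 bracketJ_nth bracketK_nth)
qed (auto simp: direct_sum_decomposition_graded_comp subspace_graded_comp)

section \<open>The two gradings of L in coordinates\<close>

lemma span_left: "spanL {(axis i 1, 0)} =
  {p :: 'f::field six_space. (\<forall>j. j \<noteq> i \<longrightarrow> fst p $ j = 0) \<and> snd p = 0}"
  unfolding vp.p.span_singleton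
proof safe
  fix a b :: "'f three_space"
  assume "\<forall>j. j \<noteq> i \<longrightarrow> fst (a, b) $ j = 0" "snd (a, b) = 0"
  then show "(a, b) \<in> range (\<lambda>k. scaleL k (axis i 1, 0))"
    by (intro range_eqI[of _ _ "a $ i"]) (auto simp: vp.scale_def vec_eq_iff axis_def)
qed (auto simp: vp.scale_def axis_def)

lemma span_right: "spanL {(0, axis i 1)} =
  {p :: 'f::field six_space. fst p = 0 \<and> (\<forall>j. j \<noteq> i \<longrightarrow> snd p $ j = 0)}"
  unfolding vp.p.span_singleton
proof safe
  fix a b :: "'f three_space"
  assume "\<forall>j. j \<noteq> i \<longrightarrow> snd (a, b) $ j = 0" "fst (a, b) = 0"
  then show "(a, b) \<in> range (\<lambda>k. scaleL k (0, axis i 1))"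
    by (intro range_eqI[of _ _ "b $ i"]) (auto simp: vp.scale_def vec_eq_iff axis_def)
qed (auto simp: vp.scale_def axis_def)

lemma span_left_right: "spanL {(axis i 1, 0), (0, axis j 1)} =
  {p :: 'f::field six_space. (\<forall>k. k \<noteq> i \<longrightarrow> fst p $ k = 0) \<and> (\<forall>k. k \<noteq> j \<longrightarrow> snd p $ k = 0)}"
proof (intro set_eqI iffI)
  fix p :: "'f six_space"
  assume "p \<in> {p. (\<forall>k. k \<noteq> i \<longrightarrow> fst p $ k = 0) \<and> (\<forall>k. k \<noteq> j \<longrightarrow> snd p $ k = 0)}"
  then show "p \<in> spanL {(axis i 1, 0), (0, axis j 1)}"
    \<comment> \<open>Splitting off the first generator leaves a one-generator span; the scalar to
      subtract is the i-th coordinate of the J-part.\<close>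
    unfolding vp.p.span_breakdown_eq[of _ "(axis i 1, 0)"] span_right
    by (intro exI[of _ "fst p $ i"]) (auto simp: vp.scale_def vec_eq_iff axis_def)
next
  fix p :: "'f six_space"
  assume "p \<in> spanL {(axis i 1, 0), (0, axis j 1)}"
  then show "p \<in> {p. (\<forall>k. k \<noteq> i \<longrightarrow> fst p $ k = 0) \<and> (\<forall>k. k \<noteq> j \<longrightarrow> snd p $ k = 0)}"
    unfolding vp.p.span_breakdown_eq[of _ "(axis i 1, 0)"] span_right
    by (auto simp: vp.scale_def vec_eq_iff axis_def)
qed

definition five_degJ :: "3 \<Rightarrow> label" where
  "five_degJ i = (if i = 1 then L_\<alpha> else if i = 2 then L_\<beta> else L_\<gamma>)"

definition five_degK :: "3 \<Rightarrow> label" where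
  "five_degK i = (if i = 1 then L_\<alpha> else if i = 2 then L_\<delta> else L_\<mu>)"

lemma five_comp_eq: "five_comp = (graded_comp five_degJ five_degK :: _ \<Rightarrow> 'f::field six_space set)"
proof
  fix g show "five_comp g = (graded_comp five_degJ five_degK g :: 'f six_space set)"
    by (cases g) (auto simp: graded_comp_def five_degJ_def five_degK_def span_left span_right
        span_left_right hJ_def xJ_def yJ_def e1_def e2_def e3_def forall_3 vec_eq_iff)
qed

definition fine_degJ :: "3 \<Rightarrow> int \<times> bit \<times> bit" where
  "fine_degJ i = (if i = 1 then (0, 0, 0) else if i = 2 then (1, 0, 0) else (- 1, 0, 0))"

definition fine_degK :: "3 \<Rightarrow> int \<times> bit \<times> bit" where
  "fine_degK i = (if i = 1 then (0, 1, 0) else if i = 2 then (0, 0, 1) else (0, 1, 1))"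

lemma fine_comp_eq: "fine_comp = (graded_comp fine_degJ fine_degK :: _ \<Rightarrow> 'f::field six_space set)"
proof
  fix a
  show "fine_comp a = (graded_comp fine_degJ fine_degK a :: 'f six_space set)"
  \<comment> \<open>The six listed degrees are distinct, so each allows a single free coordinate;
    any other degree allows none.\<close>
  proof (cases "a \<in> {(0, 0, 0), (1, 0, 0), (- 1, 0, 0), (0, 1, 0), (0, 0, 1), (0, 1, 1)}")
    case True
    then show ?thesis
      by (elim insertE emptyE) (simp_all add: fine_comp_def graded_comp_def fine_degJ_def fine_degK_def
          span_left span_right hJ_def xJ_def yJ_def e1_def e2_def e3_def forall_3 vec_eq_iff)
  next
    case False
    then have "fine_degJ i \<noteq> a" "fine_degK i \<noteq> a" for i
      by (auto simp: fine_degJ_def fine_degK_def)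
    then have "graded_comp fine_degJ fine_degK a = ({0} :: 'f six_space set)"
      by (auto simp: graded_comp_def prod_eq_iff vec_eq_iff)
    then show ?thesis
      using False by (simp add: fine_comp_def)
  qed
qed

section \<open>Group grading, dimensions, coarsening and the Lie grading property\<close>

lemma group_grading_fine_comp: "L.group_grading (fine_comp :: _ \<Rightarrow> 'f::field six_space set)"
  unfolding fine_comp_eq
  by (rule group_grading_graded_comp) (auto simp: fine_degJ_def fine_degK_def)

text \<open>Forgets the degrees: dimensions and inclusions depend only on which span occurs.\<close>

lemma fine_comp_cases:
  obtains "fine_comp a = (spanL {(hJ, 0)} :: 'f::field six_space set)"
  | "fine_comp a = (spanL {(xJ, 0)} :: 'f six_space set)"
  | "fine_comp a = (spanL {(yJ, 0)} :: 'f six_space set)"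
  | "fine_comp a = (spanL {(0, e1)} :: 'f six_space set)"
  | "fine_comp a = (spanL {(0, e2)} :: 'f six_space set)"
  | "fine_comp a = (spanL {(0, e3)} :: 'f six_space set)"
  | "fine_comp a = ({0} :: 'f six_space set)"
  using fine_comp_def[of a, where 'f = 'f] by presburger

lemma axes_nonzero:
  "hJ \<noteq> 0" "xJ \<noteq> 0" "yJ \<noteq> 0" "e1 \<noteq> 0" "e2 \<noteq> 0" "e3 \<noteq> (0 :: 'f::field three_space)"
  by (simp_all add: hJ_def xJ_def yJ_def e1_def e2_def e3_def axis_eq_0_iff)

lemma dim_fine_comp:
  assumes "fine_comp a \<noteq> ({0} :: 'f::field six_space set)"
  shows "vp.p.dim (fine_comp a :: 'f six_space set) = 1"
proof -
  have dim: "vp.p.dim (spanL {v}) = 1" if "v \<noteq> 0" for v :: "'f six_space"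
    using that by (simp add: vp.p.dim_eq_card_independent vp.p.independent_insert)
  show ?thesis
    by (rule fine_comp_cases[of a, where 'f = 'f])
      (simp_all only: dim axes_nonzero zero_prod_def prod.inject simp_thms, use assms in simp)
qed

lemma ex_label: "(\<exists>g. P g) \<longleftrightarrow> P L_\<alpha> \<or> P L_\<beta> \<or> P L_\<gamma> \<or> P L_\<delta> \<or> P L_\<mu>"
  by (metis label.exhaust)

lemma fine_comp_subset_five_comp: "\<exists>g. fine_comp a \<subseteq> (five_comp g :: 'f::field six_space set)"
  by (rule fine_comp_cases[of a, where 'f = 'f]; unfold ex_label)
    (simp_all add: vp.p.span_mono vp.p.span_zero)

text \<open>Merging h with e1 is harmless because J and K commute: brackets with
  \<open>L_\<beta>\<close> and \<open>L_\<gamma>\<close> see only the h-part, those with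
  \<open>L_\<delta>\<close> and \<open>L_\<mu>\<close> only the e1-part, and the merged component
  brackets to zero with itself.\<close>

lemma lie_grading_five_comp: "L.lie_grading UNIV (five_comp :: _ \<Rightarrow> 'f::field six_space set)"
proof (rule L.lie_gradingI)
  show "L.direct_sum_decomposition UNIV (five_comp :: _ \<Rightarrow> 'f six_space set)"
    unfolding five_comp_eq by (rule direct_sum_decomposition_graded_comp) simp
next
  fix g
  have "spanL (insert v S) \<noteq> {0}" if "v \<noteq> 0" for v :: "'f six_space" and S
    using that vp.p.span_base[of v "insert v S"] by auto
  then show "five_comp g \<noteq> ({0} :: 'f six_space set)"
    by (cases g) (simp_all add: axes_nonzero zero_prod_def)
next
  fix g g'
  show "(\<forall>u\<in>five_comp g. \<forall>v\<in>five_comp g'. bracketL u v = (0 :: 'f six_space)) \<or>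
    (\<exists>g''\<in>UNIV. \<forall>u\<in>five_comp g. \<forall>v\<in>five_comp g'. bracketL u v \<in> (five_comp g'' :: 'f six_space set))"
    unfolding five_comp_eq bex_UNIV ex_label
    by (cases g; cases g'; simp add: graded_comp_def five_degJ_def five_degK_def forall_3
        vec_eq_iff bracketJ_nth bracketK_nth bracketL_def zero_prod_def)
qed

section \<open>Failure of the semigroup property\<close>

lemma not_semigroup_realization_five_comp:
  "\<not> L.semigroup_realization UNIV (five_comp :: _ \<Rightarrow> 'f::field six_space set) mult \<iota>"
proof
  assume real: "L.semigroup_realization UNIV (five_comp :: _ \<Rightarrow> 'f six_space set) mult \<iota>"
  then interpret semigroup mult
    by (simp add: L.semigroup_realization_def)
  note five_simps = five_comp_eq graded_comp_def five_degJ_def five_degK_def bracketL_def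
    bracketJ_nth bracketK_nth prod_eq_iff coord_simps
  note mult = L.semigroup_realization_mult[OF real UNIV_I UNIV_I UNIV_I]
  have sub: "vp.p.subspace (five_comp g :: 'f six_space set)" for g
    by (simp add: five_comp_eq subspace_graded_comp)
  have "mult (\<iota> L_\<alpha>) (\<iota> L_\<beta>) = \<iota> L_\<beta>"
    by (rule mult[where u = "(hJ, 0)" and v = "(xJ, 0)", OF sub]) (simp_all add: five_simps)
  moreover have "mult (\<iota> L_\<beta>) (\<iota> L_\<gamma>) = \<iota> L_\<alpha>"
    by (rule mult[where u = "(xJ, 0)" and v = "(yJ, 0)", OF sub]) (simp_all add: five_simps)
  ultimately have "mult (\<iota> L_\<alpha>) (\<iota> L_\<alpha>) = \<iota> L_\<alpha>"
    by (metis assoc)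
  \<comment> \<open>The witness in \<open>L_\<alpha>\<close> changes from h to e1: the merged
    component ties the products found in J to those in K.\<close>
  moreover have "mult (\<iota> L_\<alpha>) (\<iota> L_\<delta>) = \<iota> L_\<mu>"
    by (rule mult[where u = "(0, e1)" and v = "(0, e2)", OF sub]) (simp_all add: five_simps)
  \<comment> \<open>Here the bracket is -e2, which is nonzero and lies in the same component as
    e2.\<close>
  moreover have "mult (\<iota> L_\<alpha>) (\<iota> L_\<mu>) = \<iota> L_\<delta>"
    by (rule mult[where u = "(0, e1)" and v = "(0, e3)", OF sub]) (simp_all add: five_simps)
  ultimately have "\<iota> L_\<delta> = \<iota> L_\<mu>"
    by (metis assoc)
  then show False
    using real unfolding L.semigroup_realization_def inj_on_def by blast
qed

theorem mainTheorem3: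
  shows
    "lie_algebra (*s) (bracketJ :: 'f::field three_space \<Rightarrow> _) \<and>
     vec.dim (UNIV :: 'f three_space set) = 3 \<and>
     lie_algebra.basis (*s) {hJ, xJ, yJ :: 'f three_space} \<and>
     bracketJ hJ xJ = (xJ :: 'f three_space) \<and>
     bracketJ hJ yJ = - (yJ :: 'f three_space) \<and>
     bracketJ xJ yJ = (hJ :: 'f three_space) \<and>
     lie_algebra.simple (*s) (bracketJ :: 'f three_space \<Rightarrow> _) \<and>

     lie_algebra (*s) (bracketK :: 'f three_space \<Rightarrow> _) \<and>
     lie_algebra.basis (*s) {e1, e2, e3 :: 'f three_space} \<and>
     bracketK e1 e2 = (e3 :: 'f three_space) \<and>
     bracketK e2 e3 = (e1 :: 'f three_space) \<and>
     bracketK e3 e1 = (e2 :: 'f three_space) \<and>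
     lie_algebra.simple (*s) (bracketK :: 'f three_space \<Rightarrow> _) \<and>

     lie_algebra scaleL (bracketL :: 'f six_space \<Rightarrow> _) \<and>
     vector_space.dim scaleL (UNIV :: 'f six_space set) = 6 \<and>

     lie_algebra.lie_grading scaleL (bracketL :: 'f six_space \<Rightarrow> _) UNIV five_comp \<and>

     \<not> (\<exists>(mult :: 's \<Rightarrow> 's \<Rightarrow> 's) \<iota>.
          lie_algebra.semigroup_realization scaleL (bracketL :: 'f six_space \<Rightarrow> _)
            UNIV five_comp mult \<iota>) \<and>

     lie_algebra.group_grading scaleL (bracketL :: 'f six_space \<Rightarrow> _) fine_comp \<and>
     (\<forall>a. fine_comp a \<noteq> ({0} :: 'f six_space set) \<longrightarrow>
          vector_space.dim scaleL (fine_comp a :: 'f six_space set) = 1) \<and>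
     lie_algebra.coarsening scaleL (bracketL :: 'f six_space \<Rightarrow> _)
       UNIV five_comp {a. fine_comp a \<noteq> ({0} :: 'f six_space set)} fine_comp"
proof (intro conjI allI impI)
  show "J.basis {hJ, xJ, yJ :: 'f three_space}" "K.basis {e1, e2, e3 :: 'f three_space}"
    using basis_axes by (simp_all add: hJ_def xJ_def yJ_def e1_def e2_def e3_def)
  show "\<not> (\<exists>(mult :: 's \<Rightarrow> 's \<Rightarrow> 's) \<iota>.
      L.semigroup_realization UNIV (five_comp :: _ \<Rightarrow> 'f six_space set) mult \<iota>)"
    using not_semigroup_realization_five_comp by blast
  show "L.coarsening UNIV (five_comp :: _ \<Rightarrow> 'f six_space set)
      {a. fine_comp a \<noteq> ({0} :: 'f six_space set)} fine_comp"
    \<comment> \<open>\<open>coarsening\<close> compares Lie gradings, so the group grading enters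
      through its nonzero components.\<close>
    using lie_grading_five_comp[where 'f = 'f]
      L.lie_grading_group_grading[OF group_grading_fine_comp[where 'f = 'f]]
      fine_comp_subset_five_comp by (auto simp: L.coarsening_def)
  show "vp.p.dim (fine_comp a :: 'f six_space set) = 1"
    if "fine_comp a \<noteq> ({0} :: 'f six_space set)" for a
    using that by (rule dim_fine_comp)
  show "vec.dim (UNIV :: 'f three_space set) = 3"
    by (simp add: card_cart_basis)
qed (rule lie_algebra_bracketJ lie_algebra_bracketK lie_algebra_bracketL simple_bracketJ
    simple_bracketK dim_six_space lie_grading_five_comp group_grading_fine_comp |
    simp add: coord_simps; fail)+

end
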